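(* Let $\mathcal{C}$ be the set of integer partitions satisfying all of the following: (i) no two consecutive integers both appear as parts; (ii) odd parts do not repeat; (iii) each even part appears at most twice; (iv) if an even part $2j$ appears twice, then none of $2j-3,\,2j-2,\,2j+2,\,2j+3$ appears as a part. Let - $\mathcal{P}_1$ be the set of $\pi\in\mathcal{C}$ in which $2+2$ does not occur as a sub-partition (i.e. $2$ appears at most once), - $\mathcal{P}_2$ be the set of $\pi\in\mathcal{C}$ in which $1$ does not appear as a part, - $\mathcal{P}_3$ be the set of $\pi\in\mathcal{C}$ in which none of $1,2,3$ appears as a part. Then, as formal power series in $x,q$, writing $N=i+2j+3k$, $$\sum_{\pi\in\mathcal{P}_1}x^{\ell(\pi)}q^{|\pi|}=\sum_{i,j,k\ge 0}(-1)^k\frac{x^{N}q^{N(N-1)+i+6j+3k^2+6k}}{(q;q)_i\,(q^4;q^4)_j\,(q^6;q^6)_k},$$ $$\sum_{\pi\in\mathcal{P}_2}x^{\ell(\pi)}q^{|\pi|}=\sum_{i,j,k\ge 0}(-1)^k\frac{x^{N}q^{N(N-1)+2i+2j+3k^2+6k}}{(q;q)_i\,(q^4;q^4)_j\,(q^6;q^6)_k},$$ $$\sum_{\pi\in\mathcal{P}_3}x^{\ell(\pi)}q^{|\pi|}=\sum_{i,j,k\ge 0}(-1)^k\frac{x^{N}q^{N(N-1)+4i+6j+3k^2+12k}}{(q;q)_i\,(q^4;q^4)_j\,(q^6;q^6)_k}.$$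
   Context: Partitions are finite weakly increasing sequences of positive integers (the empty partition is included); $\ell(\pi)$ is the number of parts and $|\pi|$ the sum of the parts of $\pi$. A sub-partition of a partition is a contiguous portion of it. For $n\ge 0$, $(a;q)_n=\prod_{0\le t<n}(1-aq^t)$. All identities are identities of formal power series. *)

theory Defs
  imports "HOL-Computational_Algebra.Formal_Power_Series" "HOL-Library.Sublist"
begin

definition is_partition :: "nat list \<Rightarrow> bool" where
  "is_partition \<pi> \<longleftrightarrow> sorted \<pi> \<and> (\<forall>p \<in> set \<pi>. 0 < p)"

(* The number of parts and the weight of \<pi> are length \<pi> and sum_list \<pi>. *)

(* The last condition is phrased over int because 2 * j - 3 may be negative. *)
definition class_C :: "nat list set" where
  "class_C = {\<pi>. is_partition \<pi> \<and>
     (\<forall>a. \<not> (a \<in> set \<pi> \<and> a + 1 \<in> set \<pi>)) \<and>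
     (\<forall>a. odd a \<longrightarrow> count_list \<pi> a \<le> 1) \<and>
     (\<forall>a. even a \<longrightarrow> count_list \<pi> a \<le> 2) \<and>
     (\<forall>j. count_list \<pi> (2 * j) = 2 \<longrightarrow>
        (\<forall>p \<in> set \<pi>. int p \<notin> {2 * int j - 3, 2 * int j - 2, 2 * int j + 2, 2 * int j + 3}))}"

definition class_P1 :: "nat list set" where
  "class_P1 = {\<pi> \<in> class_C. \<not> sublist [2, 2] \<pi>}"

definition class_P2 :: "nat list set" where
  "class_P2 = {\<pi> \<in> class_C. 1 \<notin> set \<pi>}"

definition class_P3 :: "nat list set" where
  "class_P3 = {\<pi> \<in> class_C. 1 \<notin> set \<pi> \<and> 2 \<notin> set \<pi> \<and> 3 \<notin> set \<pi>}"

(* Series in x and q are series in x over the ring of series in q. *)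

type_synonym xq_series = "rat fps fps"

abbreviation var_q :: "rat fps" where "var_q \<equiv> fps_X"
abbreviation var_x :: xq_series where "var_x \<equiv> fps_X"

(* The coefficient of x^n q^m. *)
abbreviation xq_coeff :: "xq_series \<Rightarrow> nat \<Rightarrow> nat \<Rightarrow> rat" where
  "xq_coeff f n m \<equiv> fps_nth (fps_nth f n) m"

definition qpoch :: "'a::comm_ring_1 \<Rightarrow> 'a \<Rightarrow> nat \<Rightarrow> 'a" where
  "qpoch a q n = (\<Prod>t<n. 1 - a * q ^ t)"

(* Infinite sums are taken coefficientwise. The library topology on rat fps fps is not
   usable here: it is discrete on the coefficients, which are series in q, and infinitely
   many partitions have the same number of parts. *)

definition xq_summable :: "('i \<Rightarrow> xq_series) \<Rightarrow> 'i set \<Rightarrow> bool" where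
  "xq_summable F I \<longleftrightarrow> (\<forall>n m. finite {i \<in> I. xq_coeff (F i) n m \<noteq> 0})"

definition xq_sum :: "('i \<Rightarrow> xq_series) \<Rightarrow> 'i set \<Rightarrow> xq_series" where
  "xq_sum F I = Abs_fps (\<lambda>n. Abs_fps (\<lambda>m. \<Sum>i \<in> {i \<in> I. xq_coeff (F i) n m \<noteq> 0}. xq_coeff (F i) n m))"

definition partition_term :: "nat list \<Rightarrow> xq_series" where
  "partition_term \<pi> = var_x ^ length \<pi> * fps_const (var_q ^ sum_list \<pi>)"

(* The truncated subtraction in N * (N - 1) is harmless: the product is 0 at N = 0. *)
definition triple_term :: "nat \<Rightarrow> nat \<Rightarrow> nat \<Rightarrow> nat \<times> nat \<times> nat \<Rightarrow> xq_series" where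
  "triple_term a b c = (\<lambda>(i, j, k). let N = i + 2 * j + 3 * k in
     (-1) ^ k * var_x ^ N *
     fps_const (var_q ^ (N * (N - 1) + a * i + b * j + 3 * k ^ 2 + c * k) /
       (qpoch var_q var_q i * qpoch (var_q ^ 4) (var_q ^ 4) j * qpoch (var_q ^ 6) (var_q ^ 6) k)))"

end

theory Submission
  imports Defs
begin

text \<open>
  Let \<open>D\<^sub>k\<close> count the partitions in \<open>\<C>\<close> with all parts at least \<open>k\<close>, and \<open>E\<^sub>k\<close> those among them in
  which the least even number \<open>\<ge> k\<close> occurs at most once; the three series are \<open>E\<^sub>1\<close>, \<open>D\<^sub>2\<close>, \<open>D\<^sub>4\<close>.
  Removing the smallest parts gives \<open>D\<^sub>2 = E\<^sub>2 + x\<^sup>2q\<^sup>4D\<^sub>6\<close>, \<open>E\<^sub>2 = D\<^sub>3 + xq\<^sup>2E\<^sub>4\<close>, \<open>D\<^sub>3 = D\<^sub>4 + xq\<^sup>3E\<^sub>5\<close>,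
  \<open>E\<^sub>1 = E\<^sub>2 + xqE\<^sub>3\<close>, and lowering all parts by 2 identifies \<open>D\<^sub>k\<^sub>+\<^sub>2(x)\<close> with \<open>D\<^sub>k(xq\<^sup>2)\<close> and likewise
  for \<open>E\<close>. Together with the constant term this system determines the series. Writing \<open>S(a, b, c)\<close>
  for the triple sum with \<open>a i + b j + c k\<close> in the exponent, \<open>D\<^sub>2 = S(2, 2, 6)\<close>, \<open>E\<^sub>2 = S(2, 6, 6)\<close>,
  \<open>D\<^sub>3 = S(3, 6, 6)\<close>, \<open>E\<^sub>1 = S(1, 6, 6)\<close> solves it: shifting \<open>i\<close>, \<open>j\<close> or \<open>k\<close> by one yields contiguous
  relations, three of the equations are instances of them, and the one for \<open>D\<^sub>3\<close> follows by iterating.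
\<close>

section \<open>Triple series and their contiguous relations\<close>

text \<open>Separate inverses instead of one quotient, so that shifting one index touches a single
  factor; \<open>xq_coeff_triple_term\<close> links this form to \<open>triple_term\<close>.\<close>

definition triple_coeff :: "nat \<Rightarrow> nat \<Rightarrow> nat \<Rightarrow> nat \<times> nat \<times> nat \<Rightarrow> rat fps" where
  "triple_coeff a b c = (\<lambda>(i, j, k). let N = i + 2 * j + 3 * k in
     (-1) ^ k * var_q ^ (N * (N - 1) + a * i + b * j + 3 * k ^ 2 + c * k) *
     (inverse (qpoch var_q var_q i) * inverse (qpoch (var_q ^ 4) (var_q ^ 4) j) *
      inverse (qpoch (var_q ^ 6) (var_q ^ 6) k)))"

definition triple_index :: "nat \<Rightarrow> (nat \<times> nat \<times> nat) set" where
  "triple_index n = {(i, j, k). i + 2 * j + 3 * k = n}"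

text \<open>The power of x in a term is its \<open>N\<close>, so every coefficient of the triple sum
  in x is a finite sum.\<close>

definition triple_series :: "nat \<Rightarrow> nat \<Rightarrow> nat \<Rightarrow> xq_series" where
  "triple_series a b c = Abs_fps (\<lambda>n. \<Sum>t \<in> triple_index n. triple_coeff a b c t)"

text \<open>The substitution of x q^d for x.\<close>

definition x_scale :: "nat \<Rightarrow> xq_series \<Rightarrow> xq_series" where
  "x_scale d f = Abs_fps (\<lambda>n. var_q ^ (d * n) * fps_nth f n)"

lemma finite_triple_index [simp]: "finite (triple_index n)"
  by (rule finite_subset[of _ "{..n} \<times> {..n} \<times> {..n}"]) (auto simp: triple_index_def)

lemma qpoch_Suc: "qpoch a q (Suc n) = qpoch a q n * (1 - a * q ^ n)"
  by (simp add: qpoch_def)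

lemma qpoch_nth_0:
  assumes "r > 0"
  shows "fps_nth (qpoch (var_q ^ r) (var_q ^ r) n) 0 = 1"
  using assms by (induction n) (simp_all add: qpoch_Suc, simp add: qpoch_def)

lemma inverse_qpoch_Suc:
  assumes "r > 0"
  shows "inverse (qpoch (var_q ^ r) (var_q ^ r) (Suc n)) * (1 - var_q ^ (r * Suc n)) =
    inverse (qpoch (var_q ^ r) (var_q ^ r) n)"
proof -
  let ?u = "1 - var_q ^ (r * Suc n)"
  have eq: "qpoch (var_q ^ r) (var_q ^ r) (Suc n) = qpoch (var_q ^ r) (var_q ^ r) n * ?u"
    by (simp add: qpoch_Suc power_add power_mult)
  have "inverse ?u * ?u = 1"
    using assms by (intro inverse_mult_eq_1) simp
  then show ?thesis
    by (simp add: eq fps_inverse_mult mult.assoc)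
qed

text \<open>Raising \<open>a\<close> by 1 multiplies the term by q^(i+1), so the difference carries
  the factor 1 - q^(i+1), which cancels the last factor of the denominator. Passing from M to M + 1,
  N(N-1) grows by 2M = 2i + 4j + 6k, which is spread over the three linear exponents.\<close>

lemma triple_coeff_Suc_i:
  "triple_coeff a b c (Suc i, j, k) - triple_coeff (a + 1) b c (Suc i, j, k) =
    var_q ^ a * triple_coeff (a + 2) (b + 4) (c + 6) (i, j, k)"
proof -
  define M where "M = i + 2 * j + 3 * k"
  have M: "Suc i + 2 * j + 3 * k = M + 1" by (simp add: M_def)
  have "(M + 1) * (M + 1 - 1) = M * (M - 1) + 2 * M" by (cases M) auto
  then have e: "(M + 1) * (M + 1 - 1) + a * Suc i + b * j + 3 * k ^ 2 + c * k =
      a + (M * (M - 1) + (a + 2) * i + (b + 4) * j + 3 * k ^ 2 + (c + 6) * k)"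
    by (simp add: M_def algebra_simps)
  \<comment> \<open>With the second exponent written as the first plus \<open>Suc i\<close>,
    \<open>e\<close> rewrites both terms of the difference.\<close>
  have e': "(M + 1) * (M + 1 - 1) + (a + 1) * Suc i + b * j + 3 * k ^ 2 + c * k =
      ((M + 1) * (M + 1 - 1) + a * Suc i + b * j + 3 * k ^ 2 + c * k) + 1 * Suc i"
    by simp
  have i: "inverse (qpoch var_q var_q i) =
      inverse (qpoch var_q var_q (Suc i)) * (1 - var_q ^ (1 * Suc i))"
    using inverse_qpoch_Suc[of 1 i] by simp
  show ?thesis
    unfolding triple_coeff_def prod.case Let_def M M_def[symmetric] e' unfolding e i power_add
    by (simp add: algebra_simps)
qed

text \<open>As for i, but the base q^4 makes \<open>b\<close> move by 4, and N moves by 2, so that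
  N(N-1) grows by 4M + 2.\<close>

lemma triple_coeff_Suc_j:
  "triple_coeff a b c (i, Suc j, k) - triple_coeff a (b + 4) c (i, Suc j, k) =
    var_q ^ (b + 2) * triple_coeff (a + 4) (b + 8) (c + 12) (i, j, k)"
proof -
  define M where "M = i + 2 * j + 3 * k"
  have M: "i + 2 * Suc j + 3 * k = M + 2" by (simp add: M_def)
  have "(M + 2) * (M + 2 - 1) = M * (M - 1) + 4 * M + 2" by (cases M) auto
  then have e: "(M + 2) * (M + 2 - 1) + a * i + b * Suc j + 3 * k ^ 2 + c * k =
      (b + 2) + (M * (M - 1) + (a + 4) * i + (b + 8) * j + 3 * k ^ 2 + (c + 12) * k)"
    by (simp add: M_def algebra_simps)
  have e': "(M + 2) * (M + 2 - 1) + a * i + (b + 4) * Suc j + 3 * k ^ 2 + c * k =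
      ((M + 2) * (M + 2 - 1) + a * i + b * Suc j + 3 * k ^ 2 + c * k) + 4 * Suc j"
    by (simp add: distrib_right)
  have j: "inverse (qpoch (var_q ^ 4) (var_q ^ 4) j) =
      inverse (qpoch (var_q ^ 4) (var_q ^ 4) (Suc j)) * (1 - var_q ^ (4 * Suc j))"
    using inverse_qpoch_Suc[of 4 j] by simp
  show ?thesis
    unfolding triple_coeff_def prod.case Let_def M M_def[symmetric] e' unfolding e j power_add
    by (simp add: algebra_simps)
qed

text \<open>Now N moves by 3: N(N-1) grows by 6M + 6 and 3k^2 by 6k + 3, whence 9 = 6 + 3 and 24 =
  18 + 6. The minus sign comes from \<open>(-1) ^ k\<close>.\<close>

lemma triple_coeff_Suc_k:
  "triple_coeff a b c (i, j, Suc k) - triple_coeff a b (c + 6) (i, j, Suc k) =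
    - (var_q ^ (c + 9) * triple_coeff (a + 6) (b + 12) (c + 24) (i, j, k))"
proof -
  define M where "M = i + 2 * j + 3 * k"
  have M: "i + 2 * j + 3 * Suc k = M + 3" by (simp add: M_def)
  have "(M + 3) * (M + 3 - 1) = M * (M - 1) + 6 * M + 6" by (cases M) (auto simp: algebra_simps)
  then have e: "(M + 3) * (M + 3 - 1) + a * i + b * j + 3 * (Suc k) ^ 2 + c * Suc k =
      (c + 9) + (M * (M - 1) + (a + 6) * i + (b + 12) * j + 3 * k ^ 2 + (c + 24) * k)"
    by (simp add: M_def algebra_simps power2_eq_square)
  have e': "(M + 3) * (M + 3 - 1) + a * i + b * j + 3 * (Suc k) ^ 2 + (c + 6) * Suc k =
      ((M + 3) * (M + 3 - 1) + a * i + b * j + 3 * (Suc k) ^ 2 + c * Suc k) + 6 * Suc k"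
    by (simp add: distrib_right)
  have k: "inverse (qpoch (var_q ^ 6) (var_q ^ 6) k) =
      inverse (qpoch (var_q ^ 6) (var_q ^ 6) (Suc k)) * (1 - var_q ^ (6 * Suc k))"
    using inverse_qpoch_Suc[of 6 k] by simp
  show ?thesis
    unfolding triple_coeff_def prod.case Let_def M M_def[symmetric] e' unfolding e k power_add
    by (simp add: algebra_simps)
qed

text \<open>Common core of the three relations below, where \<open>\<sigma>\<close> raises one index
  by 1 and hence N by \<open>d\<close>: the terms missed by \<open>\<sigma>\<close> vanish, and
  reindexing along it extracts x^d.\<close>

lemma sum_triple_index_shift:
  fixes f g :: "nat \<times> nat \<times> nat \<Rightarrow> rat fps"
  assumes inj: "inj \<sigma>"
    and index: "\<And>m t. \<sigma> t \<in> triple_index m \<longleftrightarrow> d \<le> m \<and> t \<in> triple_index (m - d)"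
    and zero: "\<And>t. t \<notin> range \<sigma> \<Longrightarrow> f t = 0"
    and shift: "\<And>t. f (\<sigma> t) = C * g t"
  shows "Abs_fps (\<lambda>n. \<Sum>t \<in> triple_index n. f t) =
    var_x ^ d * fps_const C * Abs_fps (\<lambda>n. \<Sum>t \<in> triple_index n. g t)"
proof (rule fps_ext)
  fix n
  have "(\<Sum>t \<in> triple_index n. f t) = (\<Sum>t \<in> triple_index n \<inter> range \<sigma>. f t)"
    using zero by (intro sum.mono_neutral_right) auto
  also have "triple_index n \<inter> range \<sigma> = \<sigma> ` {t. \<sigma> t \<in> triple_index n}" by blast
  also have "(\<Sum>t \<in> \<dots>. f t) = (\<Sum>t \<in> {t. \<sigma> t \<in> triple_index n}. C * g t)"
    using inj by (subst sum.reindex) (auto simp: shift intro: inj_on_subset)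
  finally show "fps_nth (Abs_fps (\<lambda>n. \<Sum>t \<in> triple_index n. f t)) n =
      fps_nth (var_x ^ d * fps_const C * Abs_fps (\<lambda>n. \<Sum>t \<in> triple_index n. g t)) n"
    by (auto simp: index mult.assoc fps_X_power_mult_nth sum_distrib_left)
qed

lemma triple_series_diff:
  "triple_series a b c - triple_series a' b' c' =
    Abs_fps (\<lambda>n. \<Sum>t \<in> triple_index n. triple_coeff a b c t - triple_coeff a' b' c' t)"
  by (rule fps_ext) (simp add: triple_series_def sum_subtractf)

lemma triple_series_i:
  "triple_series a b c - triple_series (Suc a) b c =
    var_x ^ 1 * fps_const (var_q ^ a) * triple_series (a + 2) (b + 4) (c + 6)"
  unfolding triple_series_diff triple_series_def[of "a + 2"]
proof (rule sum_triple_index_shift[where \<sigma> = "\<lambda>(i, j, k). (Suc i, j, k)"])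
  show "triple_coeff a b c t - triple_coeff (Suc a) b c t = 0"
    if "t \<notin> range (\<lambda>(i, j, k). (Suc i, j, k))" for t
  proof (cases t)
    case (fields i j k)
    \<comment> \<open>At \<open>i = 0\<close> the coefficient does not depend on \<open>a\<close>,
      so the difference vanishes.\<close>
    with that have "i = 0" by (cases i) (auto simp: image_iff)
    with fields show ?thesis by (simp add: triple_coeff_def)
  qed
qed (auto simp: inj_def triple_index_def triple_coeff_Suc_i[simplified])

lemma triple_series_j:
  "triple_series a b c - triple_series a (b + 4) c =
    var_x ^ 2 * fps_const (var_q ^ (b + 2)) * triple_series (a + 4) (b + 8) (c + 12)"
  unfolding triple_series_diff triple_series_def[of "a + 4"]
proof (rule sum_triple_index_shift[where \<sigma> = "\<lambda>(i, j, k). (i, Suc j, k)"])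
  show "triple_coeff a b c t - triple_coeff a (b + 4) c t = 0"
    if "t \<notin> range (\<lambda>(i, j, k). (i, Suc j, k))" for t
  proof (cases t)
    case (fields i j k)
    with that have "j = 0" by (cases j) (auto simp: image_iff)
    with fields show ?thesis by (simp add: triple_coeff_def)
  qed
qed (auto simp: inj_def triple_index_def triple_coeff_Suc_j[simplified])

lemma triple_series_k:
  "triple_series a b c - triple_series a b (c + 6) =
    var_x ^ 3 * fps_const (- (var_q ^ (c + 9))) * triple_series (a + 6) (b + 12) (c + 24)"
  unfolding triple_series_diff triple_series_def[of "a + 6"]
proof (rule sum_triple_index_shift[where \<sigma> = "\<lambda>(i, j, k). (i, j, Suc k)"])
  show "triple_coeff a b c t - triple_coeff a b (c + 6) t = 0"
    if "t \<notin> range (\<lambda>(i, j, k). (i, j, Suc k))" for t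
  proof (cases t)
    case (fields i j k)
    with that have "k = 0" by (cases k) (auto simp: image_iff)
    with fields show ?thesis by (simp add: triple_coeff_def)
  qed
qed (auto simp: inj_def triple_index_def triple_coeff_Suc_k[simplified])

text \<open>For N = n the factor q^(d n) splits into q^(d i + 2 d j + 3 d k).\<close>

lemma x_scale_triple_series:
  "x_scale d (triple_series a b c) = triple_series (a + d) (b + 2 * d) (c + 3 * d)"
proof (rule fps_ext)
  fix n
  have "var_q ^ (d * n) * triple_coeff a b c t = triple_coeff (a + d) (b + 2 * d) (c + 3 * d) t"
    if "t \<in> triple_index n" for t
  proof (cases t)
    case (fields i j k)
    with that have n: "n = i + 2 * j + 3 * k" by (simp add: triple_index_def)
    have e: "n * (n - 1) + (a + d) * i + (b + 2 * d) * j + 3 * k ^ 2 + (c + 3 * d) * k =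
        d * n + (n * (n - 1) + a * i + b * j + 3 * k ^ 2 + c * k)"
      by (simp add: n algebra_simps)
    show ?thesis
      unfolding fields triple_coeff_def prod.case Let_def n[symmetric] e power_add[of _ "d * n"]
      by (simp only: ac_simps)
  qed
  then show "fps_nth (x_scale d (triple_series a b c)) n =
      fps_nth (triple_series (a + d) (b + 2 * d) (c + 3 * d)) n"
    by (simp add: x_scale_def triple_series_def sum_distrib_left)
qed

text \<open>
  The difference \<open>T\<close> of the two sides satisfies \<open>T(x) = x\<^sup>3 q\<^sup>2\<^sup>1 T(x q\<^sup>6)\<close>, which forces \<open>T = 0\<close>.
\<close>
lemma triple_series_mixed_relation:
  "triple_series 5 10 12 =
    triple_series 5 14 18 + var_x ^ 2 * fps_const (var_q ^ 12) * triple_series 10 18 30"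
proof -
  define Q :: xq_series where "Q = fps_const var_q"
  have const: "fps_const (var_q ^ m) = Q ^ m" for m by (simp add: Q_def)
  define T where "T = triple_series 5 10 12 - triple_series 5 14 18 -
    var_x ^ 2 * fps_const (var_q ^ 12) * triple_series 10 18 30"
  \<comment> \<open>The substitution also acts on the prefactor: x^2 q^12 becomes x^2 q^24.\<close>
  have scale: "x_scale 6 T = triple_series 11 22 30 - triple_series 11 26 36 -
      var_x ^ 2 * fps_const (var_q ^ 24) * triple_series 16 30 48"
  proof -
    have "x_scale 6 T = x_scale 6 (triple_series 5 10 12) - x_scale 6 (triple_series 5 14 18) -
        var_x ^ 2 * fps_const (var_q ^ 24) * x_scale 6 (triple_series 10 18 30)"
      by (rule fps_ext)
        (auto simp: T_def x_scale_def mult.assoc fps_X_power_mult_nth algebra_simps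
          simp flip: power_add)
    then show ?thesis by (simp add: x_scale_triple_series)
  qed
  \<comment> \<open>A j-shift and a k-shift lead from (5, 10, 12) to (5, 14, 18); an i-shift and a
    k-shift lead from (9, 18, 24) to (10, 18, 30). The three remainders are x^3 q^21 times the three
    terms of T(x q^6).\<close>
  have rels: "triple_series 5 10 12 = triple_series 5 14 12 + var_x ^ 2 * Q ^ 12 * triple_series 9 18 24"
    "triple_series 5 14 12 = triple_series 5 14 18 - var_x ^ 3 * Q ^ 21 * triple_series 11 26 36"
    "triple_series 9 18 24 = triple_series 10 18 24 + var_x * Q ^ 9 * triple_series 11 22 30"
    "triple_series 10 18 24 = triple_series 10 18 30 - var_x ^ 3 * Q ^ 33 * triple_series 16 30 48"
    using triple_series_j[of 5 10 12] triple_series_k[of 5 14 12] triple_series_i[of 9 18 24]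
      triple_series_k[of 10 18 24]
    by (simp_all add: const algebra_simps flip: fps_const_neg)
  have T_eq: "T = var_x ^ 3 * fps_const (var_q ^ 21) * x_scale 6 T"
    unfolding scale unfolding T_def const rels by algebra
  \<comment> \<open>Coefficients of index below 3 vanish and the others reduce to index
    \<open>n - 3\<close>.\<close>
  have rec: "fps_nth T n = (if n < 3 then 0 else var_q ^ 21 * (var_q ^ (6 * (n - 3)) * fps_nth T (n - 3)))" for n
    by (subst T_eq) (simp add: mult.assoc fps_X_power_mult_nth x_scale_def)
  have "fps_nth T n = 0" for n
  proof (induction n rule: less_induct)
    case (less n)
    then show ?case by (subst rec) simp
  qed
  then have "T = 0" by (simp add: fps_eq_iff)
  then show ?thesis by (simp add: T_def diff_eq_eq add.commute)
qed

text \<open>An i-shift followed by a k-shift leaves x q^3 S(5, 10, 12) - x^3 q^15 S(10, 18, 30),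
  which the mixed relation contracts to x q^3 S(5, 14, 18).\<close>

lemma triple_series_3_6_6:
  "triple_series 3 6 6 =
    triple_series 4 6 12 + var_x * fps_const (var_q ^ 3) * triple_series 5 14 18"
proof -
  define Q :: xq_series where "Q = fps_const var_q"
  have const: "fps_const (var_q ^ m) = Q ^ m" for m by (simp add: Q_def)
  have rels: "triple_series 3 6 6 = triple_series 4 6 6 + var_x * Q ^ 3 * triple_series 5 10 12"
    "triple_series 4 6 6 = triple_series 4 6 12 - var_x ^ 3 * Q ^ 15 * triple_series 10 18 30"
    using triple_series_i[of 3 6 6] triple_series_k[of 4 6 6]
    by (simp_all add: const algebra_simps flip: fps_const_neg)
  show ?thesis
    unfolding rels triple_series_mixed_relation const by algebra
qed

section \<open>The infinite triple sum as a triple series\<close>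

lemma xq_coeff_triple_term:
  "fps_nth (triple_term a b c t) n = (if t \<in> triple_index n then triple_coeff a b c t else 0)"
proof (cases t)
  case (fields i j k)
  define D where "D = qpoch var_q var_q i * qpoch (var_q ^ 4) (var_q ^ 4) j *
    qpoch (var_q ^ 6) (var_q ^ 6) k"
  \<comment> \<open>Constant term 1 makes \<open>D\<close> a unit, so dividing by it is multiplying
    by its inverse.\<close>
  have "fps_nth D 0 = 1"
    using qpoch_nth_0[of 1 i] qpoch_nth_0[of 4 j] qpoch_nth_0[of 6 k] by (simp add: D_def)
  then have div: "f / D = f * (inverse (qpoch var_q var_q i) *
      inverse (qpoch (var_q ^ 4) (var_q ^ 4) j) * inverse (qpoch (var_q ^ 6) (var_q ^ 6) k))" for f
    by (simp add: fps_divide_unit D_def fps_inverse_mult)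
  have sign: "(-1) ^ k = fps_const ((-1) ^ k :: rat fps)"
    by (simp flip: fps_const_power fps_const_neg)
  show ?thesis
    unfolding fields triple_term_def triple_coeff_def prod.case Let_def D_def[symmetric] div
      triple_index_def sign
    by (auto simp: mult.assoc fps_X_power_mult_nth mult.left_commute[of _ "var_x ^ _"])
qed

lemma xq_summable_triple_term: "xq_summable (triple_term a b c) UNIV"
  unfolding xq_summable_def
  by (intro allI, rule finite_subset[OF _ finite_triple_index])
    (auto simp: xq_coeff_triple_term split: if_splits)

lemma xq_sum_triple_term: "xq_sum (triple_term a b c) UNIV = triple_series a b c"
proof (intro fps_ext)
  fix n m
  have "(\<Sum>t \<in> {t \<in> UNIV. xq_coeff (triple_term a b c t) n m \<noteq> 0}. xq_coeff (triple_term a b c t) n m) =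
      (\<Sum>t \<in> triple_index n. fps_nth (triple_coeff a b c t) m)"
    by (rule sum.mono_neutral_cong_left) (auto simp: xq_coeff_triple_term split: if_splits)
  then show "xq_coeff (xq_sum (triple_term a b c) UNIV) n m = xq_coeff (triple_series a b c) n m"
    by (simp add: xq_sum_def triple_series_def fps_sum_nth)
qed

section \<open>Partitions with a lower bound on the parts, and their shift by 2\<close>

definition parts_ge :: "nat \<Rightarrow> nat list set" where
  "parts_ge k = {\<pi> \<in> class_C. \<forall>p \<in> set \<pi>. k \<le> p}"

text \<open>\<open>2 * ((k + 1) div 2)\<close> is the least even number that is at least \<open>k\<close>.\<close>
definition parts_ge_once :: "nat \<Rightarrow> nat list set" where
  "parts_ge_once k = {\<pi> \<in> parts_ge k. count_list \<pi> (2 * ((k + 1) div 2)) \<le> 1}"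

text \<open>Numbers that are not parts have count 0, so the quantifiers may range over parts only.
  With sums in place of integer differences, the conditions can then be compared part by part after
  a shift or a \<open>Cons\<close>.\<close>

lemma class_C_iff:
  "\<pi> \<in> class_C \<longleftrightarrow> is_partition \<pi> \<and>
     (\<forall>a \<in> set \<pi>. a + 1 \<notin> set \<pi>) \<and>
     (\<forall>a \<in> set \<pi>. odd a \<longrightarrow> count_list \<pi> a \<le> 1) \<and>
     (\<forall>a \<in> set \<pi>. even a \<longrightarrow> count_list \<pi> a \<le> 2) \<and>
     (\<forall>a \<in> set \<pi>. even a \<longrightarrow> count_list \<pi> a = 2 \<longrightarrow>
        (\<forall>p \<in> set \<pi>. p + 3 \<noteq> a \<and> p + 2 \<noteq> a \<and> p \<noteq> a + 2 \<and> p \<noteq> a + 3))"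
    (is "_ \<longleftrightarrow> ?P \<and> ?A \<and> ?B \<and> ?C \<and> ?D")
proof -
  have n0: "count_list \<pi> a \<le> n" if "a \<notin> set \<pi>" for a n
    using that by (simp add: count_notin)
  have mem: "a \<in> set \<pi>" if "count_list \<pi> a = 2" for a
    using that by (metis count_notin zero_neq_numeral)
  have D: "(\<forall>j. count_list \<pi> (2 * j) = 2 \<longrightarrow>
        (\<forall>p \<in> set \<pi>. int p \<notin> {2 * int j - 3, 2 * int j - 2, 2 * int j + 2, 2 * int j + 3})) \<longleftrightarrow> ?D"
    (is "?E \<longleftrightarrow> _")
  proof
    assume E: ?E
    show ?D
    proof (intro ballI impI)
      fix a p assume a: "even a" "count_list \<pi> a = 2" "p \<in> set \<pi>"
      then obtain j where "a = 2 * j" by blast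
      with E a have "int p \<notin> {2 * int j - 3, 2 * int j - 2, 2 * int j + 2, 2 * int j + 3}" by blast
      then show "p + 3 \<noteq> a \<and> p + 2 \<noteq> a \<and> p \<noteq> a + 2 \<and> p \<noteq> a + 3"
        unfolding \<open>a = 2 * j\<close> by auto
    qed
  next
    assume E: ?D
    show ?E
    proof (intro ballI allI impI)
      fix j p assume a: "count_list \<pi> (2 * j) = 2" "p \<in> set \<pi>"
      then have "p + 3 \<noteq> 2 * j \<and> p + 2 \<noteq> 2 * j \<and> p \<noteq> 2 * j + 2 \<and> p \<noteq> 2 * j + 3"
        using E mem by simp
      then show "int p \<notin> {2 * int j - 3, 2 * int j - 2, 2 * int j + 2, 2 * int j + 3}"
        by auto
    qed
  qed
  have A: "(\<forall>a. \<not> (a \<in> set \<pi> \<and> a + 1 \<in> set \<pi>)) \<longleftrightarrow> ?A" by blast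
  have B: "(\<forall>a. odd a \<longrightarrow> count_list \<pi> a \<le> 1) \<longleftrightarrow> ?B" using n0[of _ 1] by blast
  have C: "(\<forall>a. even a \<longrightarrow> count_list \<pi> a \<le> 2) \<longleftrightarrow> ?C" using n0[of _ 2] by blast
  show ?thesis
    unfolding class_C_def mem_Collect_eq A B C D by (rule refl)
qed

lemma count_list_map_inj: "inj f \<Longrightarrow> count_list (map f xs) (f x) = count_list xs x"
  by (induction xs) (auto simp: inj_def)

text \<open>The conditions see only differences, parities and multiplicities. Positivity is assumed
  because a part 0 would become the legal part 2.\<close>

lemma map_add_2_mem_class_C:
  assumes "\<forall>p \<in> set \<pi>. 0 < p"
  shows "map ((+) 2) \<pi> \<in> class_C \<longleftrightarrow> \<pi> \<in> class_C"
proof -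
  have c: "count_list (map ((+) 2) \<pi>) (Suc (Suc a)) = count_list \<pi> a" for a
    using count_list_map_inj[of "(+) 2" \<pi> a] by simp
  have s: "sorted (map ((+) 2) \<pi>) = sorted \<pi>"
    by (simp add: sorted_map)
  have add_3: "x + 3 = Suc (Suc (Suc x))" "3 + x = Suc (Suc (Suc x))" for x :: nat by simp_all
  show ?thesis
    unfolding class_C_iff is_partition_def s using assms
    by (auto simp: c image_iff add_3)
qed

lemma map_add_2_image:
  assumes "\<forall>p \<in> set \<pi>. 2 \<le> p"
  obtains \<sigma> where "\<pi> = map ((+) (2 :: nat)) \<sigma>"
proof
  show "\<pi> = map ((+) 2) (map (\<lambda>p. p - 2) \<pi>)"
    using assms by (subst map_map, subst map_idI) auto
qed

lemma parts_ge_add_2: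
  assumes "k > 0"
  shows "parts_ge (k + 2) = map ((+) 2) ` parts_ge k"
proof (intro equalityI subsetI)
  fix \<pi> assume \<pi>: "\<pi> \<in> parts_ge (k + 2)"
  then have "\<forall>p \<in> set \<pi>. 2 \<le> p" by (auto simp: parts_ge_def)
  then obtain \<sigma> where \<sigma>: "\<pi> = map ((+) 2) \<sigma>" by (rule map_add_2_image)
  with \<pi> assms have "\<forall>p \<in> set \<sigma>. k \<le> p" by (auto simp: parts_ge_def)
  with \<pi> assms map_add_2_mem_class_C[of \<sigma>] have "\<sigma> \<in> parts_ge k"
    by (force simp: parts_ge_def \<sigma>)
  with \<sigma> show "\<pi> \<in> map ((+) 2) ` parts_ge k" by blast
next
  fix \<pi> assume "\<pi> \<in> map ((+) 2) ` parts_ge k"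
  then obtain \<sigma> where \<sigma>: "\<pi> = map ((+) 2) \<sigma>" "\<sigma> \<in> parts_ge k" by blast
  with assms map_add_2_mem_class_C[of \<sigma>] show "\<pi> \<in> parts_ge (k + 2)"
    by (force simp: parts_ge_def)
qed

lemma parts_ge_once_add_2:
  assumes "k > 0"
  shows "parts_ge_once (k + 2) = map ((+) 2) ` parts_ge_once k"
proof -
  \<comment> \<open>The even number whose multiplicity is restricted moves along with the
    parts.\<close>
  have e: "2 * ((k + 2 + 1) div 2) = 2 + 2 * ((k + 1) div 2)" by simp
  have "count_list (map ((+) 2) \<sigma>) (2 + 2 * ((k + 1) div 2)) = count_list \<sigma> (2 * ((k + 1) div 2))" for \<sigma>
    by (rule count_list_map_inj) simp
  then show ?thesis
    unfolding parts_ge_once_def e parts_ge_add_2[OF assms] by auto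
qed

section \<open>Removing the smallest parts\<close>

text \<open>Across a gap of at least 2, a single \<open>v\<close> can violate only (iv), through a
  doubled even part equal to v + 2 or v + 3. Exactly one of these is even, namely the least even
  number that is at least v + 2.\<close>

lemma Cons_mem_class_C:
  assumes "0 < v" and "\<forall>p \<in> set \<pi>. v + 2 \<le> p"
  shows "v # \<pi> \<in> class_C \<longleftrightarrow> \<pi> \<in> class_C \<and> count_list \<pi> (2 * ((v + 2 + 1) div 2)) \<le> 1"
proof -
  let ?e = "2 * ((v + 2 + 1) div 2)"
  have e: "?e = (if even v then v + 2 else v + 3)" by (auto elim!: evenE oddE)
  have v: "v \<notin> set \<pi>" "v + 1 \<notin> set \<pi>" using assms by auto
  have one: "count_list (v # \<pi>) a = count_list \<pi> a" if "a \<in> set \<pi>" for a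
    using that v by auto
  have cv: "count_list (v # \<pi>) v = 1" using v by (simp add: count_notin)
  have ee: "a = ?e" if "a \<in> set \<pi>" "even a" "v + 3 = a \<or> v + 2 = a" for a
    using that e by auto
  have e3: "even ?e" "v + 3 = ?e \<or> v + 2 = ?e" using e by auto
  have cle: "count_list \<pi> ?e \<le> 1 \<longleftrightarrow> count_list \<pi> ?e \<noteq> 2" if "\<pi> \<in> class_C"
  proof -
    have "count_list \<pi> ?e \<le> 2" using that by (simp add: class_C_def)
    then show ?thesis by linarith
  qed
  have sorted: "is_partition (v # \<pi>) \<longleftrightarrow> is_partition \<pi>"
    using assms by (fastforce simp: is_partition_def)
  show ?thesis
  proof
    assume L: "v # \<pi> \<in> class_C"
    have R: "\<pi> \<in> class_C"
      using L unfolding class_C_iff sorted by (simp add: one del: count_list.simps)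
    have "count_list \<pi> ?e \<noteq> 2"
    proof
      assume "count_list \<pi> ?e = 2"
      then have "?e \<in> set \<pi>" by (metis count_notin zero_neq_numeral)
      with L one \<open>count_list \<pi> ?e = 2\<close> e3 show False
        unfolding class_C_iff by (metis list.set_intros)
    qed
    with R cle show "\<pi> \<in> class_C \<and> count_list \<pi> ?e \<le> 1" by simp
  next
    assume R: "\<pi> \<in> class_C \<and> count_list \<pi> ?e \<le> 1"
    then have ne: "count_list \<pi> ?e \<noteq> 2" by simp
    have far: "p + 3 \<noteq> a \<and> p + 2 \<noteq> a \<and> p \<noteq> a + 2 \<and> p \<noteq> a + 3"
      if "a \<in> set (v # \<pi>)" "even a" "count_list (v # \<pi>) a = 2" "p \<in> set (v # \<pi>)" for a p
    proof -
      have "a \<noteq> v" using that cv by auto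
      with that have a: "a \<in> set \<pi>" "count_list \<pi> a = 2" using one by auto
      \<comment> \<open>Conflicts within \<open>\<pi>\<close> are excluded by assumption; for
        \<open>p = v\<close> a conflict would force \<open>a = ?e\<close>, which is not
        doubled.\<close>
      show ?thesis
      proof (cases "p = v")
        case True
        have "v + 2 \<le> a" using assms a by blast
        moreover have "a \<noteq> ?e" using ne a by auto
        then have "v + 3 \<noteq> a \<and> v + 2 \<noteq> a" using ee that a by blast
        ultimately show ?thesis using True by simp
      next
        case False
        with that a R show ?thesis unfolding class_C_iff by simp
      qed
    qed
    show "v # \<pi> \<in> class_C"
      unfolding class_C_iff sorted
    proof (intro conjI)
      show "is_partition \<pi>" using R by (simp add: class_C_iff)
      show "\<forall>a \<in> set (v # \<pi>). a + 1 \<notin> set (v # \<pi>)"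
        using R v assms by (fastforce simp: class_C_iff)
      show "\<forall>a \<in> set (v # \<pi>). odd a \<longrightarrow> count_list (v # \<pi>) a \<le> 1"
        using R v one cv by (auto simp: class_C_iff simp del: count_list.simps)
      show "\<forall>a \<in> set (v # \<pi>). even a \<longrightarrow> count_list (v # \<pi>) a \<le> 2"
        using R v one cv by (auto simp: class_C_iff simp del: count_list.simps)
    qed (use far in blast)
  qed
qed

text \<open>A doubled \<open>v\<close> excludes a third \<open>v\<close> by (iii), v + 1 by (i), and
  v + 2 and v + 3 by (iv). Conversely, no condition reaches across a gap of 4.\<close>

lemma Cons_Cons_mem_class_C:
  assumes "0 < v" "even v" and "\<forall>p \<in> set \<pi>. v \<le> p"
  shows "v # v # \<pi> \<in> class_C \<longleftrightarrow> \<pi> \<in> class_C \<and> (\<forall>p \<in> set \<pi>. v + 4 \<le> p)"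
proof
  assume L: "v # v # \<pi> \<in> class_C"
  then have "count_list (v # v # \<pi>) v \<le> 2" by (simp add: class_C_iff)
  then have c: "count_list \<pi> v = 0" by simp
  then have v: "v \<notin> set \<pi>" by (metis count_list_0_iff)
  have ge: "v + 4 \<le> p" if p: "p \<in> set \<pi>" for p
  proof -
    have "p \<noteq> v" "p \<noteq> v + 1" "p \<noteq> v + 2" "p \<noteq> v + 3" "v \<le> p"
      using L p v c assms by (auto simp: class_C_iff)
    then show ?thesis by linarith
  qed
  have one: "count_list (v # v # \<pi>) a = count_list \<pi> a" if "a \<in> set \<pi>" for a
    using that v by auto
  have "\<pi> \<in> class_C"
    using L unfolding class_C_iff is_partition_def by (simp add: one del: count_list.simps)
  with ge show "\<pi> \<in> class_C \<and> (\<forall>p \<in> set \<pi>. v + 4 \<le> p)" by blast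
next
  assume R: "\<pi> \<in> class_C \<and> (\<forall>p \<in> set \<pi>. v + 4 \<le> p)"
  then have ge: "\<And>p. p \<in> set \<pi> \<Longrightarrow> v + 4 \<le> p" by blast
  then have v: "v \<notin> set \<pi>" by force
  have one: "count_list (v # v # \<pi>) a = count_list \<pi> a" if "a \<in> set \<pi>" for a
    using that v by auto
  have cv: "count_list (v # v # \<pi>) v = 2" using v by (simp add: count_notin)
  have "is_partition (v # v # \<pi>)"
    using R assms by (auto simp: class_C_iff is_partition_def)
  moreover have "\<forall>a \<in> set (v # v # \<pi>). a + 1 \<notin> set (v # v # \<pi>)"
    using R ge by (fastforce simp: class_C_iff)
  moreover have "\<forall>a \<in> set (v # v # \<pi>). odd a \<longrightarrow> count_list (v # v # \<pi>) a \<le> 1"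
    using R one assms by (auto simp: class_C_iff simp del: count_list.simps)
  moreover have "\<forall>a \<in> set (v # v # \<pi>). even a \<longrightarrow> count_list (v # v # \<pi>) a \<le> 2"
    using R one cv by (auto simp: class_C_iff simp del: count_list.simps)
  moreover have "p + 3 \<noteq> a \<and> p + 2 \<noteq> a \<and> p \<noteq> a + 2 \<and> p \<noteq> a + 3"
    if "a \<in> set (v # v # \<pi>)" "even a" "count_list (v # v # \<pi>) a = 2" "p \<in> set (v # v # \<pi>)" for a p
  proof (cases "a \<in> set \<pi> \<and> p \<in> set \<pi>")
    case True
    with that one R show ?thesis unfolding class_C_iff by metis
  next
    case False
    with that have "a = v \<and> (p = v \<or> v + 4 \<le> p) \<or> p = v \<and> v + 4 \<le> a" using ge by auto
    then show ?thesis by auto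
  qed
  ultimately show "v # v # \<pi> \<in> class_C" unfolding class_C_iff by blast
qed

lemma sorted_head_cases:
  assumes "sorted \<pi>" "\<forall>p \<in> set \<pi>. k \<le> p"
  obtains "\<forall>p \<in> set \<pi>. k + 1 \<le> (p :: nat)" | \<sigma> where "\<pi> = k # \<sigma>" "\<forall>p \<in> set \<sigma>. k \<le> p"
proof (cases \<pi>)
  case (Cons p \<sigma>)
  show ?thesis
  proof (cases "p = k")
    case True
    then show ?thesis using Cons assms by (intro that(2)) auto
  next
    case False
    then show ?thesis using Cons assms by (intro that(1)) fastforce
  qed
qed (use that(1) in simp)

lemma sorted_if_class_C: "\<pi> \<in> class_C \<Longrightarrow> sorted \<pi>"
  by (simp add: class_C_def is_partition_def)

text \<open>The cases are that \<open>k\<close> is absent, leads once, or leads twice. In the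
  second, (i) rules out k + 1 and so widens the gap to 2; in the third, (ii) forces \<open>k\<close>
  to be even.\<close>

lemma class_C_cases:
  assumes "\<pi> \<in> class_C" "\<forall>p \<in> set \<pi>. k \<le> p"
  obtains "\<forall>p \<in> set \<pi>. k + 1 \<le> p"
  | \<sigma> where "\<pi> = k # \<sigma>" "\<forall>p \<in> set \<sigma>. k + 2 \<le> p"
  | \<sigma> where "even k" "\<pi> = k # k # \<sigma>" "\<forall>p \<in> set \<sigma>. k \<le> p"
proof -
  have "sorted \<pi>" using assms by (simp add: sorted_if_class_C)
  from this assms(2) show ?thesis
  proof (cases rule: sorted_head_cases)
    case 1
    then show ?thesis by (rule that(1))
  next
    case (2 \<sigma>)
    then have "sorted \<sigma>" using \<open>sorted \<pi>\<close> by simp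
    from this 2(2) show ?thesis
    proof (cases rule: sorted_head_cases)
      case 1
      have "k + 2 \<le> p" if "p \<in> set \<sigma>" for p
      proof -
        have "p \<noteq> k + 1" using assms(1) that unfolding 2 class_C_iff by auto
        moreover have "k + 1 \<le> p" using 1 that by blast
        ultimately show ?thesis by simp
      qed
      with 2(1) show ?thesis by (intro that(2)) blast+
    next
      case (2 \<tau>)
      note eq = \<open>\<pi> = k # \<sigma>\<close> 2
      have "even k"
      proof (rule ccontr)
        assume "odd k"
        then have "count_list \<pi> k \<le> 1" using assms(1) by (simp add: class_C_def)
        then show False by (simp add: eq)
      qed
      with eq show ?thesis by (intro that(3)) blast+
    qed
  qed
qed

text \<open>Split by whether \<open>k\<close> is doubled; the rest behind a doubled \<open>k\<close>
  is described by \<open>Cons_Cons_mem_class_C\<close>.\<close>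

lemma parts_ge_even:
  assumes "0 < k" "even k"
  shows "parts_ge k = parts_ge_once k \<union> (\<lambda>\<pi>. k # k # \<pi>) ` parts_ge (k + 4)" (is "_ = ?R")
    and "parts_ge_once k \<inter> (\<lambda>\<pi>. k # k # \<pi>) ` parts_ge (k + 4) = {}"
proof -
  \<comment> \<open>An even \<open>k\<close> is itself the least even number that is at least
    \<open>k\<close>.\<close>
  have e: "2 * ((k + 1) div 2) = k" "2 * (Suc k div 2) = k" using assms by auto
  show "parts_ge k = ?R"
  proof (intro equalityI subsetI)
    fix \<pi> assume "\<pi> \<in> parts_ge k"
    then have \<pi>: "\<pi> \<in> class_C" "\<forall>p \<in> set \<pi>. k \<le> p" by (auto simp: parts_ge_def)
    then show "\<pi> \<in> ?R"
    proof (cases rule: class_C_cases)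
      case 1
      then have "k \<notin> set \<pi>" by auto
      with \<pi> show ?thesis by (simp add: parts_ge_once_def parts_ge_def e count_notin)
    next
      case (2 \<sigma>)
      then have "k \<notin> set \<sigma>" by auto
      with \<pi> 2 show ?thesis by (simp add: parts_ge_once_def parts_ge_def e count_notin)
    next
      case (3 \<sigma>)
      with \<pi> assms Cons_Cons_mem_class_C[of k \<sigma>] show ?thesis by (simp add: parts_ge_def)
    qed
  next
    fix \<pi> assume "\<pi> \<in> ?R"
    then show "\<pi> \<in> parts_ge k"
    proof
      assume "\<pi> \<in> (\<lambda>\<pi>. k # k # \<pi>) ` parts_ge (k + 4)"
      then obtain \<sigma> where "\<pi> = k # k # \<sigma>" "\<sigma> \<in> parts_ge (k + 4)" by blast
      with assms Cons_Cons_mem_class_C[of k \<sigma>] show ?thesis by (force simp: parts_ge_def)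
    qed (simp add: parts_ge_once_def)
  qed
  show "parts_ge_once k \<inter> (\<lambda>\<pi>. k # k # \<pi>) ` parts_ge (k + 4) = {}"
    by (auto simp: parts_ge_once_def e)
qed

text \<open>The condition found in \<open>Cons_mem_class_C\<close> is the one defining
  \<open>parts_ge_once (k + 2)\<close>; this is how the classes E enter the recursion.\<close>

lemma Cons_mem_parts_ge:
  assumes "0 < k" and "\<forall>p \<in> set \<sigma>. k + 2 \<le> p"
  shows "k # \<sigma> \<in> parts_ge k \<longleftrightarrow> \<sigma> \<in> parts_ge_once (k + 2)"
proof -
  have "\<forall>p \<in> set (k # \<sigma>). k \<le> p" using assms(2) by (auto dest: bspec)
  then show ?thesis
    unfolding parts_ge_def parts_ge_once_def mem_Collect_eq Cons_mem_class_C[OF assms]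
    using assms(2) by simp
qed

lemma parts_ge_once_even:
  assumes "0 < k" "even k"
  shows "parts_ge_once k = parts_ge (k + 1) \<union> Cons k ` parts_ge_once (k + 2)" (is "_ = ?R")
proof -
  have e: "2 * ((k + 1) div 2) = k" "2 * (Suc k div 2) = k" using assms by auto
  show ?thesis
  proof (intro equalityI subsetI)
    fix \<pi> assume \<pi>: "\<pi> \<in> parts_ge_once k"
    then have "\<pi> \<in> class_C" "\<forall>p \<in> set \<pi>. k \<le> p" by (auto simp: parts_ge_once_def parts_ge_def)
    then show "\<pi> \<in> ?R"
    proof (cases rule: class_C_cases)
      case 1
      with \<open>\<pi> \<in> class_C\<close> show ?thesis by (simp add: parts_ge_def)
    next
      case (2 \<sigma>)
      moreover have "\<pi> \<in> parts_ge k" using \<pi> by (simp add: parts_ge_once_def)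
      ultimately show ?thesis using assms Cons_mem_parts_ge[of k \<sigma>] by blast
    next
      case (3 \<sigma>)
      with \<pi> show ?thesis by (simp add: parts_ge_once_def e)
    qed
  next
    fix \<pi> assume "\<pi> \<in> ?R"
    then show "\<pi> \<in> parts_ge_once k"
    proof
      assume \<pi>: "\<pi> \<in> parts_ge (k + 1)"
      then have "k \<notin> set \<pi>" by (auto simp: parts_ge_def)
      with \<pi> show ?thesis unfolding parts_ge_once_def e by (auto simp: parts_ge_def)
    next
      assume "\<pi> \<in> Cons k ` parts_ge_once (k + 2)"
      then obtain \<sigma> where \<sigma>: "\<pi> = k # \<sigma>" "\<sigma> \<in> parts_ge_once (k + 2)" by blast
      then have "\<forall>p \<in> set \<sigma>. k + 2 \<le> p" by (auto simp: parts_ge_once_def parts_ge_def)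
      moreover from this have "k \<notin> set \<sigma>" by auto
      ultimately show ?thesis using \<sigma> assms Cons_mem_parts_ge[of k \<sigma>]
        by (simp add: parts_ge_once_def[of k] e count_notin)
    qed
  qed
qed

text \<open>An odd \<open>k\<close> cannot be doubled, so only its absence or a single occurrence
  remains.\<close>

lemma parts_ge_odd:
  assumes "odd k"
  shows "parts_ge k = parts_ge (k + 1) \<union> Cons k ` parts_ge_once (k + 2)" (is "_ = ?R")
proof -
  have k: "0 < k" using assms by (simp add: odd_pos)
  show ?thesis
  proof (intro equalityI subsetI)
    fix \<pi> assume \<pi>: "\<pi> \<in> parts_ge k"
    then have "\<pi> \<in> class_C" "\<forall>p \<in> set \<pi>. k \<le> p" by (auto simp: parts_ge_def)
    then show "\<pi> \<in> ?R"
    proof (cases rule: class_C_cases)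
      case 1
      with \<open>\<pi> \<in> class_C\<close> show ?thesis by (simp add: parts_ge_def)
    next
      case (2 \<sigma>)
      with \<pi> k Cons_mem_parts_ge[of k \<sigma>] show ?thesis by blast
    qed (use assms in simp)
  next
    fix \<pi> assume "\<pi> \<in> ?R"
    then show "\<pi> \<in> parts_ge k"
    proof
      assume "\<pi> \<in> Cons k ` parts_ge_once (k + 2)"
      then obtain \<sigma> where \<sigma>: "\<pi> = k # \<sigma>" "\<sigma> \<in> parts_ge_once (k + 2)" by blast
      then have "\<forall>p \<in> set \<sigma>. k + 2 \<le> p" by (auto simp: parts_ge_once_def parts_ge_def)
      then show ?thesis using \<sigma> k Cons_mem_parts_ge[of k \<sigma>] by simp
    qed (auto simp: parts_ge_def)
  qed
qed

text \<open>For odd \<open>k\<close> both \<open>k\<close> and k + 1 restrict the multiplicity of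
  the same even number k + 1. Behind a leading \<open>k\<close> that number does not occur, so the
  restriction holds there by itself.\<close>

lemma parts_ge_once_odd:
  assumes "odd k"
  shows "parts_ge_once k = parts_ge_once (k + 1) \<union> Cons k ` parts_ge_once (k + 2)"
proof -
  have e: "2 * ((k + 1) div 2) = k + 1" "2 * ((k + 1 + 1) div 2) = k + 1"
    using assms by (auto elim!: oddE)
  have "count_list (k # \<sigma>) (k + 1) \<le> 1" if "\<sigma> \<in> parts_ge_once (k + 2)" for \<sigma>
  proof -
    have "k + 1 \<notin> set \<sigma>" using that by (auto simp: parts_ge_once_def parts_ge_def)
    then show ?thesis by (simp add: count_notin)
  qed
  then show ?thesis
    unfolding parts_ge_once_def[of k] parts_ge_once_def[of "k + 1"] parts_ge_odd[OF assms] e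
    by auto
qed

section \<open>Identifying the three classes\<close>

text \<open>Equal entries of a sorted list are adjacent.\<close>

lemma sublist_pair_iff_count_list:
  assumes "sorted \<pi>"
  shows "sublist [a, a] \<pi> \<longleftrightarrow> 2 \<le> count_list \<pi> a"
proof
  assume "sublist [a, a] \<pi>"
  then obtain ps ss where "\<pi> = ps @ [a, a] @ ss" by (auto simp: sublist_def)
  then show "2 \<le> count_list \<pi> a" by simp
next
  assume "2 \<le> count_list \<pi> a"
  with assms show "sublist [a, a] \<pi>"
  proof (induction \<pi>)
    case (Cons p \<pi>)
    show ?case
    proof (cases "2 \<le> count_list \<pi> a")
      case True
      with Cons show ?thesis by (simp add: sublist_Cons_right)
    next
      case False
      with Cons.prems have p: "p = a" and "count_list \<pi> a \<noteq> 0"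
        by (auto split: if_splits)
      then have "a \<in> set \<pi>" by (metis count_notin)
      then obtain b \<tau> where \<tau>: "\<pi> = b # \<tau>" by (cases \<pi>) auto
      \<comment> \<open>Sortedness gives \<open>a \<le> b\<close>, as \<open>a\<close> is the head,
        and \<open>b \<le> a\<close>, as \<open>a\<close> occurs in
        \<open>b # \<tau>\<close>.\<close>
      have "b = a" using Cons.prems \<open>a \<in> set \<pi>\<close> by (auto simp: \<tau> p)
      then show ?thesis by (simp add: \<tau> p sublist_Cons_right)
    qed
  qed simp
qed

lemma class_P1_eq: "class_P1 = parts_ge_once 1"
proof -
  have "\<pi> \<in> class_C \<Longrightarrow> \<forall>p \<in> set \<pi>. 1 \<le> p" for \<pi>
    by (auto simp: class_C_def is_partition_def)
  then show ?thesis
    by (auto simp: class_P1_def parts_ge_once_def parts_ge_def sublist_pair_iff_count_list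
        sorted_if_class_C)
qed

lemma class_C_0_notin: "\<pi> \<in> class_C \<Longrightarrow> 0 \<notin> set \<pi>"
  by (auto simp: class_C_def is_partition_def)

lemma class_P2_eq: "class_P2 = parts_ge 2"
proof -
  have "1 \<notin> set \<pi> \<longleftrightarrow> (\<forall>p \<in> set \<pi>. 2 \<le> p)" if "\<pi> \<in> class_C" for \<pi>
  proof -
    have "(\<forall>p \<in> set \<pi>. 2 \<le> p) \<longleftrightarrow> (\<forall>p \<in> set \<pi>. p \<noteq> 0 \<and> p \<noteq> 1)"
      by (rule ball_cong) auto
    with class_C_0_notin[OF that] show ?thesis by auto
  qed
  then show ?thesis unfolding class_P2_def parts_ge_def by blast
qed

lemma class_P3_eq: "class_P3 = parts_ge 4"
proof -
  have "1 \<notin> set \<pi> \<and> 2 \<notin> set \<pi> \<and> 3 \<notin> set \<pi> \<longleftrightarrow> (\<forall>p \<in> set \<pi>. 4 \<le> p)"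
    if "\<pi> \<in> class_C" for \<pi>
  proof -
    have "(\<forall>p \<in> set \<pi>. 4 \<le> p) \<longleftrightarrow> (\<forall>p \<in> set \<pi>. p \<noteq> 0 \<and> p \<noteq> 1 \<and> p \<noteq> 2 \<and> p \<noteq> 3)"
      by (rule ball_cong) auto
    with class_C_0_notin[OF that] show ?thesis by auto
  qed
  then show ?thesis unfolding class_P3_def parts_ge_def by blast
qed

section \<open>Generating functions of sets of partitions\<close>

definition partition_series :: "nat list set \<Rightarrow> xq_series" where
  "partition_series P = Abs_fps (\<lambda>n. Abs_fps (\<lambda>m.
     of_nat (card {\<pi> \<in> P. length \<pi> = n \<and> sum_list \<pi> = m})))"

lemma xq_coeff_partition_series:
  "xq_coeff (partition_series P) n m = of_nat (card {\<pi> \<in> P. length \<pi> = n \<and> sum_list \<pi> = m})"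
  by (simp add: partition_series_def)

text \<open>No part exceeds the weight \<open>m\<close>, so these are lists of fixed length over a
  finite set.\<close>

lemma finite_length_sum_list [simp]:
  "finite {\<pi> :: nat list. \<pi> \<in> P \<and> length \<pi> = n \<and> sum_list \<pi> = m}"
  by (rule finite_subset[OF _ finite_lists_length_eq[of "{..m}" n]])
    (auto simp: member_le_sum_list)

lemma xq_coeff_partition_term:
  "xq_coeff (partition_term \<pi>) n m = (if length \<pi> = n \<and> sum_list \<pi> = m then 1 else 0)"
  by (auto simp: partition_term_def fps_X_power_nth)

lemma xq_coeff_partition_term_support:
  "{\<pi> \<in> P. xq_coeff (partition_term \<pi>) n m \<noteq> 0} =
    {\<pi> \<in> P. length \<pi> = n \<and> sum_list \<pi> = m}"
  by (auto simp: xq_coeff_partition_term)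

lemma xq_summable_partition_term: "xq_summable partition_term P"
  by (simp add: xq_summable_def xq_coeff_partition_term_support)

lemma xq_sum_partition_term: "xq_sum partition_term P = partition_series P"
proof (intro fps_ext)
  fix n m
  let ?P = "{\<pi> \<in> P. length \<pi> = n \<and> sum_list \<pi> = m}"
  have "(\<Sum>\<pi> \<in> ?P. xq_coeff (partition_term \<pi>) n m) = (\<Sum>\<pi> \<in> ?P. 1)"
    by (rule sum.cong) (simp_all add: xq_coeff_partition_term)
  then show "xq_coeff (xq_sum partition_term P) n m = xq_coeff (partition_series P) n m"
    unfolding xq_coeff_partition_series by (simp add: xq_sum_def xq_coeff_partition_term_support)
qed

lemma partition_series_Un:
  assumes "P \<inter> P' = {}"
  shows "partition_series (P \<union> P') = partition_series P + partition_series P'"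
proof (intro fps_ext)
  fix n m
  have "{\<pi> \<in> P \<union> P'. length \<pi> = n \<and> sum_list \<pi> = m} =
      {\<pi> \<in> P. length \<pi> = n \<and> sum_list \<pi> = m} \<union> {\<pi> \<in> P'. length \<pi> = n \<and> sum_list \<pi> = m}"
    by blast
  moreover have "card \<dots> = card {\<pi> \<in> P. length \<pi> = n \<and> sum_list \<pi> = m} +
      card {\<pi> \<in> P'. length \<pi> = n \<and> sum_list \<pi> = m}"
    using assms by (intro card_Un_disjoint) auto
  ultimately show "xq_coeff (partition_series (P \<union> P')) n m =
      xq_coeff (partition_series P + partition_series P') n m"
    by (simp add: xq_coeff_partition_series)
qed

lemma partition_series_Cons:
  "partition_series (Cons k ` P) = var_x * fps_const (var_q ^ k) * partition_series P"
proof (intro fps_ext)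
  fix n m
  \<comment> \<open>The case split guards the truncated subtractions \<open>n - 1\<close> and
    \<open>m - k\<close>.\<close>
  have eq: "{\<pi> \<in> Cons k ` P. length \<pi> = n \<and> sum_list \<pi> = m} =
      (if n = 0 \<or> m < k then {} else Cons k ` {\<pi> \<in> P. length \<pi> = n - 1 \<and> sum_list \<pi> = m - k})"
    by auto
  show "xq_coeff (partition_series (Cons k ` P)) n m =
      xq_coeff (var_x * fps_const (var_q ^ k) * partition_series P) n m"
    unfolding xq_coeff_partition_series eq
    by (simp add: mult.assoc fps_X_power_mult_nth xq_coeff_partition_series card_image)
qed

text \<open>Adding \<open>d\<close> to each of n parts raises the weight by d n.\<close>

lemma partition_series_map_add:
  "partition_series (map ((+) d) ` P) = x_scale d (partition_series P)"
proof (intro fps_ext)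
  fix n m
  have sum: "sum_list (map ((+) d) \<pi>) = d * length \<pi> + sum_list \<pi>" for \<pi>
    by (induction \<pi>) auto
  have eq: "{\<pi> \<in> map ((+) d) ` P. length \<pi> = n \<and> sum_list \<pi> = m} =
      (if m < d * n then {} else map ((+) d) ` {\<pi> \<in> P. length \<pi> = n \<and> sum_list \<pi> = m - d * n})"
    by (auto simp: sum)
  have "inj_on (map ((+) d)) X" for X
    by (auto simp: inj_on_def)
  then show "xq_coeff (partition_series (map ((+) d) ` P)) n m =
      xq_coeff (x_scale d (partition_series P)) n m"
    unfolding xq_coeff_partition_series eq
    by (simp add: x_scale_def fps_X_power_mult_nth xq_coeff_partition_series card_image)
qed

lemma x_scale_x_scale: "x_scale d (x_scale e f) = x_scale (d + e) f"
  by (simp add: x_scale_def mult.assoc power_add distrib_right)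

section \<open>The functional system and its unique solution\<close>

text \<open>The arguments stand for D_2, E_2, D_3 and E_1; D_4, D_6, E_3, E_4 and E_5 appear as
  their rescalings. Writing \<open>var_x ^ 1\<close> gives all shifted terms the one shape used in
  the uniqueness proof.\<close>

definition functional_system ::
    "xq_series \<Rightarrow> xq_series \<Rightarrow> xq_series \<Rightarrow> xq_series \<Rightarrow> bool" where
  "functional_system D E F G \<longleftrightarrow>
     fps_nth D 0 = 1 \<and>
     D = E + var_x ^ 2 * fps_const (var_q ^ 4) * x_scale 4 D \<and>
     E = F + var_x ^ 1 * fps_const (var_q ^ 2) * x_scale 2 E \<and>
     F = x_scale 2 D + var_x ^ 1 * fps_const (var_q ^ 3) * x_scale 4 G \<and>
     G = E + var_x ^ 1 * fps_const (var_q ^ 1) * x_scale 2 G"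

lemma functional_system_parts:
  "functional_system (partition_series (parts_ge 2)) (partition_series (parts_ge_once 2))
     (partition_series (parts_ge 3)) (partition_series (parts_ge_once 1))"
proof -
  have once_4: "parts_ge_once 4 = map ((+) 2) ` parts_ge_once 2"
    using parts_ge_once_add_2[of 2] by simp
  have once_3: "parts_ge_once 3 = map ((+) 2) ` parts_ge_once 1"
    using parts_ge_once_add_2[of 1] by (simp add: numeral_3_eq_3)
  have once_5: "parts_ge_once 5 = map ((+) 2) ` parts_ge_once 3"
    using parts_ge_once_add_2[of 3] by simp
  have ge_4: "parts_ge 4 = map ((+) 2) ` parts_ge 2"
    using parts_ge_add_2[of 2] by simp
  have ge_6: "parts_ge 6 = map ((+) 2) ` parts_ge 4"
    using parts_ge_add_2[of 4] by simp
  have scale: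
    "x_scale 2 (partition_series (parts_ge 2)) = partition_series (parts_ge 4)"
    "x_scale 4 (partition_series (parts_ge 2)) = partition_series (parts_ge 6)"
    "x_scale 2 (partition_series (parts_ge_once 2)) = partition_series (parts_ge_once 4)"
    "x_scale 2 (partition_series (parts_ge_once 1)) = partition_series (parts_ge_once 3)"
    "x_scale 4 (partition_series (parts_ge_once 1)) = partition_series (parts_ge_once 5)"
    unfolding once_5 once_4 once_3 ge_6 ge_4 partition_series_map_add x_scale_x_scale by simp_all
  have split: "partition_series P =
      partition_series A + var_x ^ 1 * fps_const (var_q ^ k) * partition_series B"
    if "P = A \<union> Cons k ` B" "A \<inter> Cons k ` B = {}" for P A B k
    unfolding that(1) partition_series_Un[OF that(2)] partition_series_Cons by simp
  have "[] \<in> parts_ge 2"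
    by (simp add: parts_ge_def class_C_def is_partition_def)
  then have "{\<pi> \<in> parts_ge 2. length \<pi> = 0 \<and> sum_list \<pi> = m} = (if m = 0 then {[]} else {})" for m
    by auto
  then have "fps_nth (partition_series (parts_ge 2)) 0 = 1"
    by (intro fps_ext) (simp add: xq_coeff_partition_series del: length_0_conv)
  moreover have "partition_series (parts_ge 2) = partition_series (parts_ge_once 2) +
      var_x ^ 2 * fps_const (var_q ^ 4) * partition_series (parts_ge 6)"
  proof -
    \<comment> \<open>Prepending 2 twice contributes (x q^2)^2 = x^2 q^4.\<close>
    have Cons_Cons: "(\<lambda>\<pi>. 2 # 2 # \<pi>) ` parts_ge 6 = Cons 2 ` Cons 2 ` parts_ge 6"
      by (simp add: image_image)
    have "partition_series ((\<lambda>\<pi>. 2 # 2 # \<pi>) ` parts_ge 6) =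
        var_x ^ 2 * fps_const (var_q ^ 4) * partition_series (parts_ge 6)"
      unfolding Cons_Cons partition_series_Cons fps_const_power[symmetric] by algebra
    moreover have "parts_ge 2 = parts_ge_once 2 \<union> (\<lambda>\<pi>. 2 # 2 # \<pi>) ` parts_ge 6"
      "parts_ge_once 2 \<inter> (\<lambda>\<pi>. 2 # 2 # \<pi>) ` parts_ge 6 = {}"
      using parts_ge_even[of 2] by simp_all
    ultimately show ?thesis
      using partition_series_Un[of "parts_ge_once 2" "(\<lambda>\<pi>. 2 # 2 # \<pi>) ` parts_ge 6"] by metis
  qed
  moreover have "partition_series (parts_ge_once 2) = partition_series (parts_ge 3) +
      var_x ^ 1 * fps_const (var_q ^ 2) * partition_series (parts_ge_once 4)"
  proof (rule split)
    show "parts_ge_once 2 = parts_ge 3 \<union> Cons 2 ` parts_ge_once 4"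
      using parts_ge_once_even[of 2] by simp
  qed (auto simp: parts_ge_def)
  moreover have "partition_series (parts_ge 3) = partition_series (parts_ge 4) +
      var_x ^ 1 * fps_const (var_q ^ 3) * partition_series (parts_ge_once 5)"
  proof (rule split)
    show "parts_ge 3 = parts_ge 4 \<union> Cons 3 ` parts_ge_once 5"
      using parts_ge_odd[of 3] by simp
  qed (auto simp: parts_ge_def)
  moreover have "partition_series (parts_ge_once 1) = partition_series (parts_ge_once 2) +
      var_x ^ 1 * fps_const (var_q ^ 1) * partition_series (parts_ge_once 3)"
  proof (rule split)
    show "parts_ge_once 1 = parts_ge_once 2 \<union> Cons 1 ` parts_ge_once 3"
      using parts_ge_once_odd[of 1] by (simp add: numeral_2_eq_2 numeral_3_eq_3)
  qed (auto simp: parts_ge_once_def parts_ge_def)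
  ultimately show ?thesis
    unfolding functional_system_def scale by - (intro conjI; assumption)
qed

text \<open>The equations for \<open>D\<close>, \<open>E\<close> and \<open>G\<close> are a j-shift
  and two i-shifts; the one for \<open>F\<close> is \<open>triple_series_3_6_6\<close>.\<close>

lemma functional_system_triple:
  "functional_system (triple_series 2 2 6) (triple_series 2 6 6) (triple_series 3 6 6)
     (triple_series 1 6 6)"
proof -
  have scale:
    "x_scale 2 (triple_series 2 2 6) = triple_series 4 6 12"
    "x_scale 4 (triple_series 2 2 6) = triple_series 6 10 18"
    "x_scale 2 (triple_series 2 6 6) = triple_series 4 10 12"
    "x_scale 2 (triple_series 1 6 6) = triple_series 3 10 12"
    "x_scale 4 (triple_series 1 6 6) = triple_series 5 14 18"
    by (simp_all add: x_scale_triple_series eval_nat_numeral)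
  have "triple_index 0 = {(0, 0, 0)}"
    by (auto simp: triple_index_def)
  then have "fps_nth (triple_series 2 2 6) 0 = 1"
    by (simp add: triple_series_def triple_coeff_def qpoch_def)
  moreover have "triple_series 2 2 6 =
      triple_series 2 6 6 + var_x ^ 2 * fps_const (var_q ^ 4) * triple_series 6 10 18"
    using triple_series_j[of 2 2 6] by (simp add: algebra_simps)
  moreover have "triple_series 2 6 6 =
      triple_series 3 6 6 + var_x ^ 1 * fps_const (var_q ^ 2) * triple_series 4 10 12"
    using triple_series_i[of 2 6 6] by (simp add: algebra_simps)
  moreover have "triple_series 3 6 6 =
      triple_series 4 6 12 + var_x ^ 1 * fps_const (var_q ^ 3) * triple_series 5 14 18"
    using triple_series_3_6_6 by simp
  moreover have "triple_series 1 6 6 =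
      triple_series 2 6 6 + var_x ^ 1 * fps_const (var_q ^ 1) * triple_series 3 10 12"
    using triple_series_i[of 1 6 6] by (simp add: algebra_simps numeral_2_eq_2 numeral_3_eq_3)
  ultimately show ?thesis
    unfolding functional_system_def scale by - (intro conjI; assumption)
qed

text \<open>Compare coefficients of x^n by induction. Terms with a positive power of x are known
  from smaller indices, and eliminating E and F leaves (1 - q^(2n)) D_n equal to a known
  series.\<close>

lemma functional_system_unique:
  assumes "functional_system D E F G" "functional_system D' E' F' G'"
  shows "D = D'" "G = G'"
proof -
  note sys = assms[unfolded functional_system_def]
  \<comment> \<open>A factor x^d with \<open>d > 0\<close> lets only coefficients of index below
    \<open>n\<close> contribute.\<close>
  have low: "fps_nth (var_x ^ d * fps_const C * x_scale e A) n =
      fps_nth (var_x ^ d * fps_const C * x_scale e A') n"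
    if "\<And>m. m < n \<Longrightarrow> fps_nth A m = fps_nth A' m" "0 < d" for d e C n and A A' :: xq_series
    using that by (simp add: mult.assoc fps_X_power_mult_nth x_scale_def)
  have "fps_nth D n = fps_nth D' n \<and> fps_nth E n = fps_nth E' n \<and> fps_nth F n = fps_nth F' n \<and>
      fps_nth G n = fps_nth G' n" for n
  proof (induction n rule: less_induct)
    case (less n)
    define \<Delta> where "\<Delta> A = fps_nth A n" for A :: xq_series
    have add: "\<Delta> (A + B) = \<Delta> A + \<Delta> B" for A B by (simp add: \<Delta>_def)
    have scale: "\<Delta> (x_scale d A) = var_q ^ (d * n) * \<Delta> A" for d A
      by (simp add: \<Delta>_def x_scale_def)
    define a b c d where "a = \<Delta> (var_x ^ 2 * fps_const (var_q ^ 4) * x_scale 4 D)"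
      and "b = \<Delta> (var_x ^ 1 * fps_const (var_q ^ 2) * x_scale 2 E)"
      and "c = \<Delta> (var_x ^ 1 * fps_const (var_q ^ 3) * x_scale 4 G)"
      and "d = \<Delta> (var_x ^ 1 * fps_const (var_q ^ 1) * x_scale 2 G)"
    have eq: "\<Delta> D = \<Delta> E + a" "\<Delta> E = \<Delta> F + b" "\<Delta> F = var_q ^ (2 * n) * \<Delta> D + c" "\<Delta> G = \<Delta> E + d"
      unfolding a_def b_def c_def d_def scale[symmetric] add[symmetric] 
      by (rule arg_cong[of _ _ \<Delta>], insert sys(1), elim conjE, assumption)+
    \<comment> \<open>By the induction hypothesis both systems have the same inhomogeneous
      terms.\<close>
    have same: "a = \<Delta> (var_x ^ 2 * fps_const (var_q ^ 4) * x_scale 4 D')"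
      "b = \<Delta> (var_x ^ 1 * fps_const (var_q ^ 2) * x_scale 2 E')"
      "c = \<Delta> (var_x ^ 1 * fps_const (var_q ^ 3) * x_scale 4 G')"
      "d = \<Delta> (var_x ^ 1 * fps_const (var_q ^ 1) * x_scale 2 G')"
      unfolding a_def b_def c_def d_def \<Delta>_def by (rule low, use less in simp, simp)+
    have eq': "\<Delta> D' = \<Delta> E' + a" "\<Delta> E' = \<Delta> F' + b" "\<Delta> F' = var_q ^ (2 * n) * \<Delta> D' + c"
        "\<Delta> G' = \<Delta> E' + d"
      unfolding same scale[symmetric] add[symmetric] 
      by (rule arg_cong[of _ _ \<Delta>], insert sys(2), elim conjE, assumption)+
    have diff: "\<Delta> D - \<Delta> E = a" "\<Delta> E - \<Delta> F = b" "\<Delta> F - var_q ^ (2 * n) * \<Delta> D = c"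
        "\<Delta> G - \<Delta> E = d"
      by (simp add: eq(1), simp add: eq(2), simp add: eq(3), simp add: eq(4))
    have diff': "\<Delta> D' - \<Delta> E' = a" "\<Delta> E' - \<Delta> F' = b" "\<Delta> F' - var_q ^ (2 * n) * \<Delta> D' = c"
        "\<Delta> G' - \<Delta> E' = d"
      by (simp add: eq'(1), simp add: eq'(2), simp add: eq'(3), simp add: eq'(4))
    have D: "\<Delta> D = \<Delta> D'"
    \<comment> \<open>At \<open>n = 0\<close> the factor 1 - q^(2n) vanishes, and the prescribed
      constant term decides instead.\<close>
    proof (cases "n = 0")
      case True
      then show ?thesis using sys by (simp add: \<Delta>_def)
    next
      case False
      then have "fps_nth (1 - var_q ^ (2 * n)) 0 = 1" by simp
      then have "1 - var_q ^ (2 * n) \<noteq> 0" by (metis fps_zero_nth zero_neq_one)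
      \<comment> \<open>Each bracket telescopes to (1 - q^(2n)) times the coefficient of
        \<open>D\<close> or \<open>D'\<close>, and both brackets equal a + b + c.\<close>
      moreover have "(1 - var_q ^ (2 * n)) * (\<Delta> D - \<Delta> D') =
          ((\<Delta> D - \<Delta> E) + (\<Delta> E - \<Delta> F) + (\<Delta> F - var_q ^ (2 * n) * \<Delta> D)) -
          ((\<Delta> D' - \<Delta> E') + (\<Delta> E' - \<Delta> F') + (\<Delta> F' - var_q ^ (2 * n) * \<Delta> D'))"
        by (simp add: algebra_simps)
      ultimately show ?thesis unfolding diff diff' by simp
    qed
    have "\<Delta> D - \<Delta> E = \<Delta> D' - \<Delta> E'" unfolding diff diff' ..
    with D have E: "\<Delta> E = \<Delta> E'" by simp
    have "\<Delta> E - \<Delta> F = \<Delta> E' - \<Delta> F'" unfolding diff diff' ..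
    with E have F: "\<Delta> F = \<Delta> F'" by simp
    have "\<Delta> G - \<Delta> E = \<Delta> G' - \<Delta> E'" unfolding diff diff' ..
    with E have G: "\<Delta> G = \<Delta> G'" by simp
    from D E F G show ?case by (simp add: \<Delta>_def)
  qed
  then show "D = D'" "G = G'" by (simp_all add: fps_eq_iff)
qed

theorem mainTheorem1:
  shows "(xq_summable partition_term class_P1 \<and>
          xq_summable (triple_term 1 6 6) UNIV \<and>
          xq_sum partition_term class_P1 = xq_sum (triple_term 1 6 6) UNIV) \<and>
         (xq_summable partition_term class_P2 \<and>
          xq_summable (triple_term 2 2 6) UNIV \<and>
          xq_sum partition_term class_P2 = xq_sum (triple_term 2 2 6) UNIV) \<and>
         (xq_summable partition_term class_P3 \<and>
          xq_summable (triple_term 4 6 12) UNIV \<and>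
          xq_sum partition_term class_P3 = xq_sum (triple_term 4 6 12) UNIV)"
proof -
  note unique = functional_system_unique[OF functional_system_parts functional_system_triple]
  \<comment> \<open>D_4 is no unknown of the system but D_2(x q^2), and rescaling S(2, 2, 6) gives
    S(4, 6, 12).\<close>
  have P3: "partition_series (parts_ge 4) = triple_series 4 6 12"
    using parts_ge_add_2[of 2] unique(1)
    by (simp add: partition_series_map_add x_scale_triple_series)
  show ?thesis
    unfolding xq_sum_partition_term xq_sum_triple_term class_P1_eq class_P2_eq class_P3_eq
    using unique P3 by (simp add: xq_summable_partition_term xq_summable_triple_term)
qed

end
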